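(* Let $\mathcal{D}\subset\mathbb{R}^m$ be compact and convex, let $d$ be a concave differentiable function on $\mathcal{D}$, and let $\lambda_1\in\mathcal{D}$ and $R>0$ be such that $\mathcal{D}\subseteq\{\lambda:\|\lambda-\lambda_1\|_\infty\le R/2\}$. Let $\varepsilon>0$ and assume that there exists an $\ell_\infty$-ball of diameter $r(\varepsilon)>0$ that is contained in $$\mathcal{D}_\varepsilon=\{\lambda\in\mathcal{D}: d(\lambda)\ge \max_{\mu\in\mathcal{D}}d(\mu)-\varepsilon\}.$$ Suppose the cutting plane scheme with approximate oracles described in the context is run with a cutting plane method of rate $\theta>0$, with gradient oracle accuracy $\varepsilon_g\le\frac{\varepsilon}{R\sqrt m}$ and value oracle accuracy $\varepsilon_v\le\varepsilon$. Then after $T=O\!\left(\frac m\theta\log(R/r(\varepsilon))\right)$ rounds it outputs $\bar\lambda\in\mathcal{D}$ such that $$\max_{\lambda\in\mathcal{D}}d(\lambda)-d(\bar\lambda)\le4\varepsilon.$$ (The $O(\cdot)$ means: there is a universal constant $C$ such that the conclusion holds for $T=\max\{1,\lceil C\frac m\theta\log(R/r(\varepsilon))\rceil\}$.)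
   Context: $\|\cdot\|$ is the Euclidean norm, $\mathrm{Vol}$ is $m$-dimensional volume. An $\ell_\infty$-ball of diameter $r$ is a cube $\{\lambda:\|\lambda-c\|_\infty\le r/2\}$. Differentiability at boundary points of $\mathcal{D}$ is understood relative to $\mathcal{D}$: $d(\mu)=d(\lambda)+\nabla d(\lambda)^\top(\mu-\lambda)+o(\|\mu-\lambda\|)$ for $\mu\in\mathcal{D}$. **Oracles.** $\mathcal{O}_g:\mathcal{D}\to\mathbb{R}^m$ and $\mathcal{O}_v:\mathcal{D}\to\mathbb{R}$ satisfy $\|\nabla d(\lambda)-\mathcal{O}_g(\lambda)\|\le\varepsilon_g$ and $|d(\lambda)-\mathcal{O}_v(\lambda)|\le\varepsilon_v$ for all $\lambda\in\mathcal{D}$. $\mathcal{O}_s$ is an exact separation oracle: for $\lambda_t\notin\mathcal{D}$ it returns $w\in\mathbb{R}^m$ with $\mathcal{D}\subseteq\{\lambda: w^\top(\lambda-\lambda_t)\le0\}$. **Cutting plane scheme with $T$ rounds.** Start with $\lambda_1$ and $M_1=\{\lambda:\|\lambda-\lambda_1\|_\infty\le R/2\}$. For $t=1,\dots,T$: if $\lambda_t\in\mathcal{D}$ set $w_t=-\mathcal{O}_g(\lambda_t)$; otherwise set $w_t=\mathcal{O}_s(\lambda_t)$. Construct a set $M_{t+1}$ with $\{\lambda\in M_t: w_t^\top(\lambda-\lambda_t)\le0\}\subseteq M_{t+1}$ and choose $\lambda_{t+1}\in M_{t+1}$. Output $\bar\lambda\in\arg\max\{\mathcal{O}_v(\lambda):\lambda\in\{\lambda_1,\dots,\lambda_T\}\cap\mathcal{D}\}$.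 Different cutting plane methods differ in how $M_{t+1}$ and $\lambda_{t+1}$ are chosen. **Rate.** A cutting plane method has rate $\theta>0$ if $\mathrm{Vol}(M_{t+1})\le e^{-\theta t}\,\mathrm{Vol}(M_1)$ for all $t\ge1$. *)

theory Defs
  imports "HOL-Analysis.Analysis"
begin

text \<open>
  The constant hidden in the O-notation must not depend on the dimension, so the dimension is
  quantified inside the statement and cannot be an index type.  A point of m-dimensional space is
  a function in the carrier \<open>Rn m\<close>: arbitrary below \<open>m\<close>, equal to \<open>undefined\<close> from \<open>m\<close> on.  This is
  the carrier shared by the library's finite product topologies and finite product measures.
\<close>

type_synonym point = "nat \<Rightarrow> real"

abbreviation Rn :: "nat \<Rightarrow> point set" where
  "Rn m \<equiv> {..<m} \<rightarrow>\<^sub>E UNIV"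

text \<open>The product topology on finitely many real lines is the Euclidean topology.\<close>

abbreviation Rn_topology :: "nat \<Rightarrow> point topology" where
  "Rn_topology m \<equiv> product_topology (\<lambda>_. euclideanreal) {..<m}"

text \<open>m-dimensional Lebesgue measure, i.e. the completion of the product Borel measure.\<close>

abbreviation Rn_lebesgue :: "nat \<Rightarrow> point measure" where
  "Rn_lebesgue m \<equiv> completion (Pi\<^sub>M {..<m} (\<lambda>_. lborel))"

definition Vol :: "nat \<Rightarrow> point set \<Rightarrow> ennreal" where
  "Vol m A = emeasure (Rn_lebesgue m) A"

definition Rn_inner :: "nat \<Rightarrow> point \<Rightarrow> point \<Rightarrow> real" where
  "Rn_inner m x y = (\<Sum>i<m. x i * y i)"

definition Rn_norm :: "nat \<Rightarrow> point \<Rightarrow> real" where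
  "Rn_norm m x = L2_set x {..<m}"

definition Rn_diff :: "nat \<Rightarrow> point \<Rightarrow> point \<Rightarrow> point" where
  "Rn_diff m x y = (\<lambda>i\<in>{..<m}. x i - y i)"

definition Rn_uminus :: "nat \<Rightarrow> point \<Rightarrow> point" where
  "Rn_uminus m x = (\<lambda>i\<in>{..<m}. - x i)"

definition Rn_mix :: "nat \<Rightarrow> real \<Rightarrow> point \<Rightarrow> point \<Rightarrow> point" where
  "Rn_mix m u x y = (\<lambda>i\<in>{..<m}. (1 - u) * x i + u * y i)"

text \<open>The second argument is the diameter, not the radius.\<close>

definition linf_ball :: "nat \<Rightarrow> real \<Rightarrow> point \<Rightarrow> point set" where
  "linf_ball m r c = {x \<in> Rn m. \<forall>i<m. \<bar>x i - c i\<bar> \<le> r / 2}"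

definition Rn_convex :: "nat \<Rightarrow> point set \<Rightarrow> bool" where
  "Rn_convex m D \<longleftrightarrow> D \<subseteq> Rn m \<and> (\<forall>x\<in>D. \<forall>y\<in>D. \<forall>u\<in>{0..1}. Rn_mix m u x y \<in> D)"

definition Rn_concave_on :: "nat \<Rightarrow> point set \<Rightarrow> (point \<Rightarrow> real) \<Rightarrow> bool" where
  "Rn_concave_on m D d \<longleftrightarrow> Rn_convex m D \<and>
     (\<forall>x\<in>D. \<forall>y\<in>D. \<forall>u\<in>{0..1}. d (Rn_mix m u x y) \<ge> (1 - u) * d x + u * d y)"

text \<open>
  Differentiability relative to \<open>D\<close>: the remainder of the first-order expansion is
  \<open>o(\<parallel>y - x\<parallel>)\<close> as \<open>y\<close> tends to \<open>x\<close> within \<open>D\<close>.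
\<close>

definition has_gradient_within ::
  "nat \<Rightarrow> point set \<Rightarrow> (point \<Rightarrow> real) \<Rightarrow> point \<Rightarrow> point \<Rightarrow> bool" where
  "has_gradient_within m D d g x \<longleftrightarrow> g \<in> Rn m \<and>
     (\<forall>e>0. \<exists>\<delta>>0. \<forall>y\<in>D. Rn_norm m (Rn_diff m y x) < \<delta> \<longrightarrow>
        \<bar>d y - d x - Rn_inner m g (Rn_diff m y x)\<bar> \<le> e * Rn_norm m (Rn_diff m y x))"

text \<open>
  For a concave function with a gradient relative to a compact \<open>D\<close>, the function is continuous
  on \<open>D\<close> and the supremum is a maximum.
\<close>

definition max_on :: "point set \<Rightarrow> (point \<Rightarrow> real) \<Rightarrow> real" where
  "max_on D d = (SUP \<mu>\<in>D. d \<mu>)"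

definition near_optimal :: "point set \<Rightarrow> (point \<Rightarrow> real) \<Rightarrow> real \<Rightarrow> point set" where
  "near_optimal D d \<epsilon> = {x \<in> D. d x \<ge> max_on D d - \<epsilon>}"

definition gradient_oracle ::
  "nat \<Rightarrow> point set \<Rightarrow> (point \<Rightarrow> point) \<Rightarrow> real \<Rightarrow> (point \<Rightarrow> point) \<Rightarrow> bool" where
  "gradient_oracle m D grad \<epsilon>\<^sub>g Og \<longleftrightarrow>
     (\<forall>x\<in>D. Og x \<in> Rn m \<and> Rn_norm m (Rn_diff m (grad x) (Og x)) \<le> \<epsilon>\<^sub>g)"

definition value_oracle ::
  "point set \<Rightarrow> (point \<Rightarrow> real) \<Rightarrow> real \<Rightarrow> (point \<Rightarrow> real) \<Rightarrow> bool" where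
  "value_oracle D d \<epsilon>\<^sub>v Ov \<longleftrightarrow> (\<forall>x\<in>D. \<bar>d x - Ov x\<bar> \<le> \<epsilon>\<^sub>v)"

definition separation_oracle :: "nat \<Rightarrow> point set \<Rightarrow> (point \<Rightarrow> point) \<Rightarrow> bool" where
  "separation_oracle m D Os \<longleftrightarrow>
     (\<forall>x \<in> Rn m - D. Os x \<in> Rn m \<and> D \<subseteq> {y. Rn_inner m (Os x) (Rn_diff m y x) \<le> 0})"

definition cut_normal ::
  "nat \<Rightarrow> point set \<Rightarrow> (point \<Rightarrow> point) \<Rightarrow> (point \<Rightarrow> point) \<Rightarrow> point \<Rightarrow> point" where
  "cut_normal m D Og Os x = (if x \<in> D then Rn_uminus m (Og x) else Os x)"

text \<open>
  A run of \<open>T\<close> rounds of the scheme, by any cutting plane method.  Query points \<open>lam\<close> and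
  localization sets \<open>M\<close> are indexed from 1 to \<open>T + 1\<close>; other indices are irrelevant.
\<close>

definition cutting_plane_run ::
  "nat \<Rightarrow> point set \<Rightarrow> (point \<Rightarrow> point) \<Rightarrow> (point \<Rightarrow> point) \<Rightarrow> point \<Rightarrow> real \<Rightarrow> nat \<Rightarrow>
   (nat \<Rightarrow> point) \<Rightarrow> (nat \<Rightarrow> point set) \<Rightarrow> bool" where
  "cutting_plane_run m D Og Os lam1 R T lam M \<longleftrightarrow>
     lam 1 = lam1 \<and> M 1 = linf_ball m R lam1 \<and>
     (\<forall>t\<in>{1..T}.
        M (t + 1) \<subseteq> Rn m \<and>
        {x \<in> M t. Rn_inner m (cut_normal m D Og Os (lam t)) (Rn_diff m x (lam t)) \<le> 0}
          \<subseteq> M (t + 1) \<and>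
        lam (t + 1) \<in> M (t + 1))"

text \<open>
  The rate bound, along a run of \<open>T\<close> rounds.  Measurability is what makes the volumes meaningful:
  \<open>emeasure\<close> is 0 on sets that are not measurable.
\<close>

definition has_rate :: "nat \<Rightarrow> nat \<Rightarrow> (nat \<Rightarrow> point set) \<Rightarrow> real \<Rightarrow> bool" where
  "has_rate m T M \<theta> \<longleftrightarrow> \<theta> > 0 \<and>
     (\<forall>t\<in>{1..T}. M (t + 1) \<in> sets (Rn_lebesgue m) \<and>
        Vol m (M (t + 1)) \<le> ennreal (exp (- \<theta> * real t)) * Vol m (M 1))"

definition scheme_output ::
  "point set \<Rightarrow> (point \<Rightarrow> real) \<Rightarrow> nat \<Rightarrow> (nat \<Rightarrow> point) \<Rightarrow> point \<Rightarrow> bool" where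
  "scheme_output D Ov T lam xbar \<longleftrightarrow> is_arg_max Ov (\<lambda>x. x \<in> lam ` {1..T} \<inter> D) xbar"

definition num_rounds :: "real \<Rightarrow> nat \<Rightarrow> real \<Rightarrow> real \<Rightarrow> real \<Rightarrow> nat" where
  "num_rounds C m \<theta> R r = max 1 (nat \<lceil>C * (real m / \<theta>) * ln (R / r)\<rceil>)"

end

(*
  The ball of near-optimal points has volume r^m, and M (T + 1) has volume at most
  exp (- \<theta> T) R^m, which is smaller once T > (m / \<theta>) ln (R / r).  So some near-optimal x is
  removed in a round t.  As x lies in D, this is not a separation round, so lam t lies in D and
  the approximate gradient at lam t has a negative inner product with x - lam t.  Concavity gives
  d x \<le> d (lam t) + \<epsilon>\<^sub>g R sqrt m, hence lam t is 2\<epsilon>-optimal; comparing approximate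
  values instead of exact ones costs another 2\<epsilon>.
*)
theory Submission
  imports Defs
begin

section \<open>Volume of cubes\<close>

lemma Vol_linf_ball:
  assumes "r \<ge> 0"
  shows "Vol m (linf_ball m r c) = ennreal (r ^ m)"
proof -
  interpret product_sigma_finite "\<lambda>_::nat. lborel :: real measure"
    by standard
  have eq: "linf_ball m r c = (\<Pi>\<^sub>E i\<in>{..<m}. {c i - r / 2..c i + r / 2})"
  proof -
    have "\<bar>x - c i\<bar> \<le> r / 2 \<longleftrightarrow> x \<in> {c i - r / 2..c i + r / 2}" for x i
      unfolding abs_le_iff atLeastAtMost_iff by linarith
    then show ?thesis
      unfolding linf_ball_def by (simp add: set_eq_iff PiE_iff Ball_def conj_commute)
  qed
  \<comment> \<open>On the product sigma-algebra the completed measure agrees with the product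
    measure, so the volume factors into interval lengths.\<close>
  have "linf_ball m r c \<in> sets (Pi\<^sub>M {..<m} (\<lambda>_. lborel))"
    unfolding eq by (intro sets_PiM_I_finite) auto
  then have "Vol m (linf_ball m r c) = emeasure (Pi\<^sub>M {..<m} (\<lambda>_. lborel)) (linf_ball m r c)"
    unfolding Vol_def by simp
  also have "\<dots> = (\<Prod>i<m. emeasure lborel {c i - r / 2..c i + r / 2})"
    unfolding eq by (intro emeasure_PiM) auto
  also have "\<dots> = ennreal (r ^ m)"
    using assms by (simp add: ennreal_power)
  finally show ?thesis .
qed

section \<open>Coordinate computations with inner products, norms and cubes\<close>

lemma Rn_norm_nonneg: "Rn_norm m x \<ge> 0"
  by (simp add: Rn_norm_def L2_set_nonneg)

lemma Rn_inner_le_norm: "Rn_inner m x y \<le> Rn_norm m x * Rn_norm m y"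
proof -
  have "Rn_inner m x y \<le> (\<Sum>i<m. \<bar>x i\<bar> * \<bar>y i\<bar>)"
    unfolding Rn_inner_def by (intro sum_mono) (metis abs_ge_self abs_mult)
  also have "\<dots> \<le> Rn_norm m x * Rn_norm m y"
    unfolding Rn_norm_def by (rule L2_set_mult_ineq)
  finally show ?thesis .
qed

lemma Rn_inner_diff_left:
  "Rn_inner m (Rn_diff m x y) z = Rn_inner m x z - Rn_inner m y z"
  by (simp add: Rn_inner_def Rn_diff_def left_diff_distrib sum_subtractf)

lemma Rn_inner_uminus_left: "Rn_inner m (Rn_uminus m x) z = - Rn_inner m x z"
  by (simp add: Rn_inner_def Rn_uminus_def sum_negf)

lemma Rn_diff_mix:
  assumes "i < m"
  shows "Rn_diff m (Rn_mix m u x y) x i = u * Rn_diff m y x i"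
  using assms by (simp add: Rn_diff_def Rn_mix_def algebra_simps)

lemma Rn_inner_diff_mix:
  "Rn_inner m g (Rn_diff m (Rn_mix m u x y) x) = u * Rn_inner m g (Rn_diff m y x)"
  by (simp add: Rn_inner_def Rn_diff_mix sum_distrib_left mult_ac)

lemma Rn_norm_diff_mix:
  assumes "u \<ge> 0"
  shows "Rn_norm m (Rn_diff m (Rn_mix m u x y) x) = u * Rn_norm m (Rn_diff m y x)"
  using assms unfolding Rn_norm_def by (subst L2_set_right_distrib) (auto intro: L2_set_cong simp: Rn_diff_mix)

text \<open>Both points are within \<open>R / 2\<close> of the centre in each of the
  \<open>m\<close> coordinates. The resulting factor cancels the denominator in the bound on the
  gradient error.\<close>

lemma linf_ball_norm_diff_le:
  assumes "x \<in> linf_ball m R c" "y \<in> linf_ball m R c" "R \<ge> 0"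
  shows "Rn_norm m (Rn_diff m x y) \<le> R * sqrt (real m)"
proof -
  have "\<bar>x i - y i\<bar> \<le> \<bar>R\<bar>" if "i < m" for i
    using assms that unfolding linf_ball_def by (smt (verit) field_sum_of_halves mem_Collect_eq)
  then have "(x i - y i)\<^sup>2 \<le> R\<^sup>2" if "i < m" for i
    using that abs_le_square_iff by blast
  then have "(\<Sum>i<m. (x i - y i)\<^sup>2) \<le> (\<Sum>i<m. R\<^sup>2)"
    by (intro sum_mono) auto
  then have "Rn_norm m (Rn_diff m x y) \<le> sqrt (real m * R\<^sup>2)"
    by (simp add: Rn_norm_def L2_set_def Rn_diff_def)
  also have "\<dots> = R * sqrt (real m)"
    using assms by (simp add: real_sqrt_mult)
  finally show ?thesis .
qed

text \<open>Opposite corners of the small cube are \<open>r\<close> apart in coordinate 0, which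
  exists since \<open>m \<ge> 1\<close>. This serves to make \<open>ln (R / r)\<close> nonnegative
  in the round count.\<close>

lemma linf_ball_subset_imp_le:
  assumes "linf_ball m r c \<subseteq> linf_ball m R b" "m \<ge> 1" "r \<ge> 0"
  shows "r \<le> R"
proof -
  have "(\<lambda>i\<in>{..<m}. c i + r / 2) \<in> linf_ball m r c" "(\<lambda>i\<in>{..<m}. c i - r / 2) \<in> linf_ball m r c"
    using assms(3) by (auto simp: linf_ball_def)
  then have "(\<lambda>i\<in>{..<m}. c i + r / 2) \<in> linf_ball m R b" "(\<lambda>i\<in>{..<m}. c i - r / 2) \<in> linf_ball m R b"
    using assms(1) by blast+
  then have "\<bar>c 0 + r / 2 - b 0\<bar> \<le> R / 2" "\<bar>c 0 - r / 2 - b 0\<bar> \<le> R / 2"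
    using assms(2) by (auto simp: linf_ball_def)
  then show ?thesis by linarith
qed

section \<open>First-order bounds for concave functions\<close>

text \<open>The gradient controls \<open>d\<close> only near \<open>x\<close>, so the expansion is
  applied at a point \<open>z\<close> of the segment towards \<open>y\<close>. Concavity makes the
  excess over the linear model at \<open>z\<close> at least \<open>u\<close> times that at
  \<open>y\<close>, while the remainder also scales with \<open>u\<close>; dividing by
  \<open>u\<close> transfers the bound to \<open>y\<close>.\<close>

lemma concave_le_gradient:
  assumes conc: "Rn_concave_on m D d" and grad: "has_gradient_within m D d g x"
    and x: "x \<in> D" and y: "y \<in> D"
  shows "d y \<le> d x + Rn_inner m g (Rn_diff m y x)"
proof (rule field_le_epsilon)
  fix e :: real
  assume "e > 0"
  define N where "N = Rn_norm m (Rn_diff m y x)"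
  \<comment> \<open>Dividing by \<open>N + 1\<close> instead of \<open>N\<close> also covers
    \<open>y = x\<close>.\<close>
  define e' where "e' = e / (N + 1)"
  have "N \<ge> 0" by (simp add: N_def Rn_norm_nonneg)
  with \<open>e > 0\<close> have "e' > 0" "e' * N \<le> e"
    by (auto simp: e'_def field_simps)
  obtain \<delta> where "\<delta> > 0" and \<delta>: "\<And>z. z \<in> D \<Longrightarrow> Rn_norm m (Rn_diff m z x) < \<delta> \<Longrightarrow>
      \<bar>d z - d x - Rn_inner m g (Rn_diff m z x)\<bar> \<le> e' * Rn_norm m (Rn_diff m z x)"
    using grad[unfolded has_gradient_within_def, THEN conjunct2, rule_format, OF \<open>e' > 0\<close>] by metis
  \<comment> \<open>The first bound keeps \<open>z\<close> on the segment; the second puts it at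
    distance \<open>u * N < \<delta>\<close> from \<open>x\<close>.\<close>
  define u where "u = min 1 (\<delta> / (2 * (N + 1)))"
  have u: "u > 0" "u \<le> 1"
    using \<open>\<delta> > 0\<close> \<open>N \<ge> 0\<close> by (auto simp: u_def)
  have "u * N \<le> \<delta> / (2 * (N + 1)) * N"
    using \<open>N \<ge> 0\<close> by (intro mult_right_mono) (auto simp: u_def)
  also have "\<dots> < \<delta>"
    using \<open>\<delta> > 0\<close> \<open>N \<ge> 0\<close> by (simp add: field_simps add_nonneg_pos)
  finally have small: "u * N < \<delta>" .
  define z where "z = Rn_mix m u x y"
  have "z \<in> D" and "d z \<ge> (1 - u) * d x + u * d y"
    using conc x y u unfolding z_def Rn_concave_on_def Rn_convex_def by auto
  moreover have "Rn_norm m (Rn_diff m z x) = u * N"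
    unfolding z_def N_def using u by (simp add: Rn_norm_diff_mix)
  moreover have "Rn_inner m g (Rn_diff m z x) = u * Rn_inner m g (Rn_diff m y x)"
    by (simp add: z_def Rn_inner_diff_mix)
  ultimately have "(1 - u) * d x + u * d y - d x - u * Rn_inner m g (Rn_diff m y x) \<le> e' * (u * N)"
    using \<delta>[of z] small by auto
  then have "u * (d y - d x - Rn_inner m g (Rn_diff m y x)) \<le> u * (e' * N)"
    by (simp add: algebra_simps)
  then have "d y - d x - Rn_inner m g (Rn_diff m y x) \<le> e' * N"
    using u by simp
  with \<open>e' * N \<le> e\<close> show "d y \<le> d x + Rn_inner m g (Rn_diff m y x) + e"
    by linarith
qed

lemma approx_gradient_cut:
  assumes "Rn_concave_on m D d" "has_gradient_within m D d g x" "x \<in> D" "y \<in> D"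
    and err: "Rn_norm m (Rn_diff m g h) \<le> \<delta>"
    and cut: "Rn_inner m h (Rn_diff m y x) \<le> 0"
  shows "d y \<le> d x + \<delta> * Rn_norm m (Rn_diff m y x)"
proof -
  have "d y \<le> d x + Rn_inner m g (Rn_diff m y x)"
    by (rule concave_le_gradient) (use assms in auto)
  \<comment> \<open>Subtracting the nonpositive inner product with \<open>h\<close> leaves only the
    gradient error, ready for Cauchy-Schwarz.\<close>
  also have "\<dots> \<le> d x + Rn_inner m (Rn_diff m g h) (Rn_diff m y x)"
    using cut by (simp add: Rn_inner_diff_left)
  also have "\<dots> \<le> d x + Rn_norm m (Rn_diff m g h) * Rn_norm m (Rn_diff m y x)"
    using Rn_inner_le_norm by simp
  also have "\<dots> \<le> d x + \<delta> * Rn_norm m (Rn_diff m y x)"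
    using err by (intro add_left_mono mult_right_mono) (auto simp: Rn_norm_nonneg)
  finally show ?thesis .
qed

section \<open>Runs of the scheme\<close>

lemma cutting_plane_run_cut_round:
  assumes run: "cutting_plane_run m D Og Os lam1 R T lam M"
    and x: "x \<in> linf_ball m R lam1" "x \<notin> M (T + 1)"
  obtains t where "t \<in> {1..T}" "Rn_inner m (cut_normal m D Og Os (lam t)) (Rn_diff m x (lam t)) > 0"
proof (rule ccontr)
  assume "\<not> thesis"
  with that have nocut: "Rn_inner m (cut_normal m D Og Os (lam t)) (Rn_diff m x (lam t)) \<le> 0"
    if "t \<in> {1..T}" for t
    using that by (meson not_less)
  \<comment> \<open>A point that satisfies every cut inequality survives from \<open>M 1\<close>
    through \<open>M (T + 1)\<close>.\<close>
  have "x \<in> M (Suc t)" if "t \<le> T" for t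
    using that
  proof (induction t)
    case 0
    then show ?case using run x by (simp add: cutting_plane_run_def)
  next
    case (Suc t)
    then have "Suc t \<in> {1..T}" "x \<in> M (Suc t)" by auto
    with nocut[of "Suc t"] run show ?case
      unfolding cutting_plane_run_def by fastforce
  qed
  with x show False by simp
qed

text \<open>The separation oracle is specified only on \<open>Rn m - D\<close>. A query after the
  first lies in the set built in round \<open>t - 1\<close>.\<close>

lemma cutting_plane_run_query_in_Rn:
  assumes "cutting_plane_run m D Og Os lam1 R T lam M" "lam1 \<in> Rn m" "t \<in> {1..T}"
  shows "lam t \<in> Rn m"
proof (cases "t = 1")
  case True
  then show ?thesis using assms by (simp add: cutting_plane_run_def)
next
  case False
  with assms(3) have "t - 1 \<in> {1..T}" "t - 1 + 1 = t"
    by auto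
  with assms(1) show ?thesis
    unfolding cutting_plane_run_def by (metis subsetD)
qed

lemma cut_normal_separation:
  assumes "separation_oracle m D Os" "x \<in> Rn m - D" "y \<in> D"
  shows "Rn_inner m (cut_normal m D Og Os x) (Rn_diff m y x) \<le> 0"
proof -
  have "D \<subseteq> {y. Rn_inner m (Os x) (Rn_diff m y x) \<le> 0}"
    using assms(1,2) unfolding separation_oracle_def by blast
  with assms show ?thesis
    by (auto simp: cut_normal_def)
qed

lemma run_near_optimal_query:
  assumes run: "cutting_plane_run m D Og Os lam1 R T lam M"
    and conc: "Rn_concave_on m D d"
    and grad: "\<And>x. x \<in> D \<Longrightarrow> has_gradient_within m D d (grad x) x"
    and Og: "gradient_oracle m D grad \<epsilon>\<^sub>g Og" and Os: "separation_oracle m D Os"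
    and lam1: "lam1 \<in> D" and R: "R > 0" and m: "m \<ge> 1" and D: "D \<subseteq> linf_ball m R lam1"
    and \<epsilon>\<^sub>g: "\<epsilon>\<^sub>g \<le> \<epsilon> / (R * sqrt (real m))" and \<epsilon>: "\<epsilon> > 0"
    and x: "x \<in> near_optimal D d \<epsilon>" "x \<notin> M (T + 1)"
  obtains t where "t \<in> {1..T}" "lam t \<in> D" "max_on D d - d (lam t) \<le> 2 * \<epsilon>"
proof -
  have xD: "x \<in> D" and dx: "d x \<ge> max_on D d - \<epsilon>"
    using x by (auto simp: near_optimal_def)
  obtain t where t: "t \<in> {1..T}"
    and cut: "Rn_inner m (cut_normal m D Og Os (lam t)) (Rn_diff m x (lam t)) > 0"
    using cutting_plane_run_cut_round[OF run _ x(2)] xD D by blast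
  have "lam1 \<in> Rn m"
    using lam1 D by (auto simp: linf_ball_def)
  then have "lam t \<in> Rn m"
    by (rule cutting_plane_run_query_in_Rn[OF run _ t])
  \<comment> \<open>A separating cut never has a positive inner product towards a point of
    \<open>D\<close>.\<close>
  then have lamD: "lam t \<in> D"
    using cut cut_normal_separation[OF Os _ xD, of "lam t" Og] by (meson DiffI not_less)
  with cut have neg: "Rn_inner m (Og (lam t)) (Rn_diff m x (lam t)) \<le> 0"
    by (simp add: cut_normal_def Rn_inner_uminus_left)
  have err: "Rn_norm m (Rn_diff m (grad (lam t)) (Og (lam t))) \<le> \<epsilon> / (R * sqrt (real m))"
    using Og lamD \<epsilon>\<^sub>g unfolding gradient_oracle_def by force
  have "d x \<le> d (lam t) + \<epsilon> / (R * sqrt (real m)) * Rn_norm m (Rn_diff m x (lam t))"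
    by (rule approx_gradient_cut[OF conc grad[OF lamD] lamD xD err neg])
  also have "\<dots> \<le> d (lam t) + \<epsilon> / (R * sqrt (real m)) * (R * sqrt (real m))"
    using xD lamD D R \<epsilon>
    by (intro add_left_mono mult_left_mono linf_ball_norm_diff_le[where c = lam1]) auto
  also have "\<dots> = d (lam t) + \<epsilon>"
    using R m by simp
  finally show thesis
    using that t lamD dx by simp
qed

section \<open>Round count and volume comparison\<close>

lemma num_rounds_gt:
  assumes "\<theta> > 0" "0 < r" "r \<le> R"
  shows "real m * ln (R / r) < \<theta> * real (num_rounds 2 m \<theta> R r)"
proof -
  define a where "a = real m / \<theta> * ln (R / r)"
  have "a \<ge> 0"
    using assms by (auto simp: a_def)
  have "real (num_rounds 2 m \<theta> R r) \<ge> 2 * a" "real (num_rounds 2 m \<theta> R r) \<ge> 1"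
    unfolding num_rounds_def a_def by (simp_all add: of_nat_max le_max_iff_disj mult.assoc real_nat_ceiling_ge)
  \<comment> \<open>The constant 2 gives strictness when \<open>a > 0\<close>; the lower bound of
    one round gives it when \<open>a = 0\<close>.\<close>
  with \<open>a \<ge> 0\<close> have "a < real (num_rounds 2 m \<theta> R r)"
    by linarith
  with assms(1) show ?thesis
    by (simp add: a_def field_simps)
qed

lemma has_rate_ball_not_subset:
  assumes rate: "has_rate m T M \<theta>" and M1: "M 1 = linf_ball m R b" and T: "T \<ge> 1"
    and r: "r > 0" and R: "R > 0" and big: "real m * ln (R / r) < \<theta> * real T"
  shows "\<not> linf_ball m r c \<subseteq> M (T + 1)"
proof
  assume sub: "linf_ball m r c \<subseteq> M (T + 1)"
  have meas: "M (T + 1) \<in> sets (Rn_lebesgue m)"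
    and vol: "Vol m (M (T + 1)) \<le> ennreal (exp (- \<theta> * real T)) * Vol m (M 1)"
    using rate T by (auto simp: has_rate_def)
  have "ennreal (r ^ m) = Vol m (linf_ball m r c)"
    using r by (simp add: Vol_linf_ball)
  \<comment> \<open>Monotonicity needs the larger set measurable, which \<open>has_rate\<close>
    supplies.\<close>
  also have "\<dots> \<le> Vol m (M (T + 1))"
    unfolding Vol_def by (rule emeasure_mono[OF sub meas])
  also have "\<dots> \<le> ennreal (exp (- \<theta> * real T)) * ennreal (R ^ m)"
    using vol R unfolding M1 by (subst (asm) Vol_linf_ball) auto
  also have "\<dots> = ennreal (exp (- \<theta> * real T) * R ^ m)"
    by (simp add: ennreal_mult')
  finally have "r ^ m \<le> exp (- \<theta> * real T) * R ^ m"
    using R by (subst (asm) ennreal_le_iff) auto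
  then have "ln (r ^ m) \<le> ln (exp (- \<theta> * real T) * R ^ m)"
    using r by (intro ln_mono) auto
  then have "real m * ln r \<le> - \<theta> * real T + real m * ln R"
    using r R by (simp add: ln_mult ln_realpow)
  with big r R show False
    by (simp add: ln_div algebra_simps)
qed

section \<open>Choice of the output by approximate values\<close>

lemma scheme_output_exists:
  assumes "lam ` {1..T} \<inter> D \<noteq> {}"
  shows "\<exists>xbar. scheme_output D Ov T lam xbar"
proof -
  let ?S = "lam ` {1..T} \<inter> D"
  have fin: "finite (Ov ` ?S)" and ne: "Ov ` ?S \<noteq> {}"
    using assms by auto
  obtain x where "x \<in> ?S" "Ov x = Max (Ov ` ?S)"
    using Max_in[OF fin ne] by (metis (no_types, lifting) imageE)
  then have "scheme_output D Ov T lam x"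
    using Max_ge[OF fin] by (auto simp: scheme_output_def is_arg_max_linorder)
  then show ?thesis by blast
qed

text \<open>One value error is paid at \<open>lam t\<close> and another at \<open>xbar\<close>,
  hence the factor 2.\<close>

lemma scheme_output_near_optimal:
  assumes out: "scheme_output D Ov T lam xbar" and Ov: "value_oracle D d \<epsilon>\<^sub>v Ov"
    and t: "t \<in> {1..T}" "lam t \<in> D"
  shows "xbar \<in> D" "d (lam t) \<le> d xbar + 2 * \<epsilon>\<^sub>v"
proof -
  show xD: "xbar \<in> D"
    using out by (simp add: scheme_output_def is_arg_max_def)
  have "Ov (lam t) \<le> Ov xbar"
    using out t by (auto simp: scheme_output_def is_arg_max_linorder)
  moreover have "\<bar>d xbar - Ov xbar\<bar> \<le> \<epsilon>\<^sub>v" "\<bar>d (lam t) - Ov (lam t)\<bar> \<le> \<epsilon>\<^sub>v"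
    using Ov xD t by (auto simp: value_oracle_def)
  ultimately show "d (lam t) \<le> d xbar + 2 * \<epsilon>\<^sub>v"
    by linarith
qed

theorem lemma3p1:
  shows "\<exists>C>0. \<forall>(m::nat) (D::point set) (d::point \<Rightarrow> real) (grad::point \<Rightarrow> point)
      (lam1::point) (R::real) (\<epsilon>::real) (r::real) (c::point)
      (\<epsilon>\<^sub>g::real) (\<epsilon>\<^sub>v::real) (Og::point \<Rightarrow> point) (Ov::point \<Rightarrow> real) (Os::point \<Rightarrow> point)
      (\<theta>::real) (T::nat) (lam::nat \<Rightarrow> point) (M::nat \<Rightarrow> point set).
    m \<ge> 1 \<longrightarrow>
    compactin (Rn_topology m) D \<longrightarrow>
    Rn_convex m D \<longrightarrow>
    Rn_concave_on m D d \<longrightarrow>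
    (\<forall>x\<in>D. has_gradient_within m D d (grad x) x) \<longrightarrow>
    lam1 \<in> D \<longrightarrow>
    R > 0 \<longrightarrow>
    D \<subseteq> linf_ball m R lam1 \<longrightarrow>
    \<epsilon> > 0 \<longrightarrow>
    r > 0 \<longrightarrow>
    c \<in> Rn m \<longrightarrow>
    linf_ball m r c \<subseteq> near_optimal D d \<epsilon> \<longrightarrow>
    gradient_oracle m D grad \<epsilon>\<^sub>g Og \<longrightarrow>
    value_oracle D d \<epsilon>\<^sub>v Ov \<longrightarrow>
    separation_oracle m D Os \<longrightarrow>
    \<epsilon>\<^sub>g \<le> \<epsilon> / (R * sqrt (real m)) \<longrightarrow>
    \<epsilon>\<^sub>v \<le> \<epsilon> \<longrightarrow>
    T = num_rounds C m \<theta> R r \<longrightarrow>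
    cutting_plane_run m D Og Os lam1 R T lam M \<longrightarrow>
    has_rate m T M \<theta> \<longrightarrow>
    (\<exists>xbar. scheme_output D Ov T lam xbar) \<and>
    (\<forall>xbar. scheme_output D Ov T lam xbar \<longrightarrow>
       xbar \<in> D \<and> max_on D d - d xbar \<le> 4 * \<epsilon>)"
proof (intro exI[of _ "2::real"] conjI allI impI, simp)
  fix m :: nat and D d grad lam1 and R \<epsilon> r :: real and c \<epsilon>\<^sub>g \<epsilon>\<^sub>v Og Ov Os
    and \<theta> :: real and T :: nat and lam :: "nat \<Rightarrow> point" and M :: "nat \<Rightarrow> point set"
  assume m: "m \<ge> 1" and conc: "Rn_concave_on m D d"
    and grad: "\<forall>x\<in>D. has_gradient_within m D d (grad x) x"
    and lam1: "lam1 \<in> D" and R: "R > 0" and D: "D \<subseteq> linf_ball m R lam1"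
    and \<epsilon>: "\<epsilon> > 0" and r: "r > 0" and Q: "linf_ball m r c \<subseteq> near_optimal D d \<epsilon>"
    and Og: "gradient_oracle m D grad \<epsilon>\<^sub>g Og" and Ov: "value_oracle D d \<epsilon>\<^sub>v Ov"
    and Os: "separation_oracle m D Os"
    and \<epsilon>\<^sub>g: "\<epsilon>\<^sub>g \<le> \<epsilon> / (R * sqrt (real m))" and \<epsilon>\<^sub>v: "\<epsilon>\<^sub>v \<le> \<epsilon>"
    and T: "T = num_rounds 2 m \<theta> R r"
    and run: "cutting_plane_run m D Og Os lam1 R T lam M" and rate: "has_rate m T M \<theta>"
  \<comment> \<open>At least one round makes the feasible point \<open>lam1\<close> a candidate for
    the output, so the maximum is over a nonempty finite set.\<close>
  have "T \<ge> 1"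
    by (simp add: T num_rounds_def)
  moreover have "lam 1 = lam1" and M1: "M 1 = linf_ball m R lam1"
    using run by (auto simp: cutting_plane_run_def)
  ultimately have "lam ` {1..T} \<inter> D \<noteq> {}"
    using lam1 by force
  then show "\<exists>xbar. scheme_output D Ov T lam xbar"
    by (rule scheme_output_exists)
  have "near_optimal D d \<epsilon> \<subseteq> D"
    by (auto simp: near_optimal_def)
  then have "r \<le> R"
    using linf_ball_subset_imp_le[of m r c R lam1] Q D m r by auto
  then have "real m * ln (R / r) < \<theta> * real T"
    using rate r unfolding T by (intro num_rounds_gt) (auto simp: has_rate_def)
  then obtain x where "x \<in> near_optimal D d \<epsilon>" "x \<notin> M (T + 1)"
    using has_rate_ball_not_subset[OF rate M1 \<open>T \<ge> 1\<close> r R] Q by blast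
  then obtain t where t: "t \<in> {1..T}" "lam t \<in> D" "max_on D d - d (lam t) \<le> 2 * \<epsilon>"
    using run_near_optimal_query[OF run conc _ Og Os lam1 R m D \<epsilon>\<^sub>g \<epsilon>] grad by blast
  fix xbar
  assume out: "scheme_output D Ov T lam xbar"
  show "xbar \<in> D"
    by (rule scheme_output_near_optimal(1)[OF out Ov t(1,2)])
  \<comment> \<open>The query \<open>lam t\<close> is \<open>2 * \<epsilon>\<close>-optimal, and
    \<open>xbar\<close> loses at most \<open>2 * \<epsilon>\<^sub>v\<close> more.\<close>
  show "max_on D d - d xbar \<le> 4 * \<epsilon>"
    using scheme_output_near_optimal(2)[OF out Ov t(1,2)] t(3) \<epsilon>\<^sub>v by linarith
qed

end
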